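(* Let $h\geq 2$ be an integer and let $A$ be a finite set of $k$ nonnegative integers with $0\in A$. Then $|h_{\pm}A|=2hk-2h+1$ if and only if $A=d*[0,k-1]$ for some positive integer $d$.
   Context: For a finite set $A=\{a_0,a_1,\ldots,a_{k-1}\}$ of integers and a positive integer $h$, the $h$-fold signed sumset of $A$ is \[h_{\pm}A=\Big\{\sum_{i=0}^{k-1}\lambda_i a_i : (\lambda_0,\ldots,\lambda_{k-1})\in\mathbb{Z}^k,\ \sum_{i=0}^{k-1}|\lambda_i|=h\Big\}.\] $[0,k-1]$ denotes the set of integers $\{0,1,\ldots,k-1\}$, and for an integer $d$ and a set $B$ of integers, $d*B=\{db : b\in B\}$. *)

theory Defs imports Main
begin

text \<open>The coefficient vector of the sum is indexed by the elements of the finite set \<open>A\<close>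
  itself; the values of \<open>c\<close> outside \<open>A\<close> play no role.\<close>

definition signed_sumset :: "nat \<Rightarrow> int set \<Rightarrow> int set" where
  "signed_sumset h A = {(\<Sum>a\<in>A. c a * a) | c :: int \<Rightarrow> int. (\<Sum>a\<in>A. \<bar>c a\<bar>) = int h}"

definition dilate :: "int \<Rightarrow> int set \<Rightarrow> int set" where
  "dilate d B = {d * b | b. b \<in> B}"

end

theory Submission imports Defs "HOL-Library.Set_Algebras"
begin

text \<open>Put \<open>B = A \<union> -A\<close>, a set of \<open>2k - 1\<close> integers. Since \<open>0 \<in> A\<close>, coefficient vectors of
  \<open>\<ell>\<^sup>1\<close>-norm at most \<open>h\<close> give the same sums as those of norm exactly \<open>h\<close>, so the signed sumset
  for \<open>h + 1\<close> contains the sum of \<open>B\<close> and the signed sumset for \<open>h\<close>. The bound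
  \<open>|X + Y| \<ge> |X| + |Y| - 1\<close> then shows that equality for \<open>h\<close> forces \<open>|B + B| = 2|B| - 1\<close>.
  With \<open>b\<^sub>0 < b\<^sub>1 < \<dots> < b\<^sub>n\<close> the elements of \<open>B\<close>, this means \<open>B + B = (b\<^sub>0 + B) \<union> (B + b\<^sub>n)\<close>;
  the \<open>n - 1\<close> sums \<open>b\<^sub>1 + b\<^sub>i\<close> with \<open>0 < i < n\<close> lie strictly between \<open>b\<^sub>0 + b\<^sub>1\<close> and \<open>b\<^sub>1 + b\<^sub>n\<close>,
  where only the \<open>n - 1\<close> sums \<open>b\<^sub>0 + b\<^sub>j\<close>, \<open>j > 1\<close>, are available, so \<open>b\<^sub>1 + b\<^sub>i = b\<^sub>0 + b\<^sub>i\<^sub>+\<^sub>1\<close> and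
  \<open>B\<close> is an arithmetic progression.\<close>

section \<open>Sumsets in ordered abelian groups\<close>

text \<open>If \<open>Min X + y = x + Max Y\<close>, then \<open>x = Min X\<close> and
  \<open>y = Max Y\<close>, so the two translates share exactly one point. The exact count serves
  both the lower bound for \<open>X + Y\<close> and its equality case.\<close>

lemma card_extreme_translates:
  fixes X Y :: "'a::linordered_ab_group_add set"
  assumes "finite X" "finite Y" "X \<noteq> {}" "Y \<noteq> {}"
  shows "card X + card Y = Suc (card ((\<lambda>y. Min X + y) ` Y \<union> (\<lambda>x. x + Max Y) ` X))"
proof -
  let ?U = "(\<lambda>y. Min X + y) ` Y" and ?V = "(\<lambda>x. x + Max Y) ` X"
  have "?U \<inter> ?V = {Min X + Max Y}"
  proof
    show "?U \<inter> ?V \<subseteq> {Min X + Max Y}"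
    proof
      fix z assume "z \<in> ?U \<inter> ?V"
      then obtain x y where "x \<in> X" "y \<in> Y" "z = Min X + y" "z = x + Max Y" by auto
      moreover have "Min X \<le> x" "y \<le> Max Y" using calculation assms by auto
      ultimately show "z \<in> {Min X + Max Y}"
        by (metis add_left_mono add_right_mono antisym singletonI)
    qed
  qed (use assms in auto)
  moreover have "card ?U = card Y" "card ?V = card X"
    by (auto intro!: card_image inj_onI)
  ultimately show ?thesis
    using card_Un_Int[of ?U ?V] assms by simp
qed

lemma extreme_translates_subset:
  fixes X Y :: "'a::linordered_ab_group_add set"
  assumes "finite X" "finite Y" "X \<noteq> {}" "Y \<noteq> {}"
  shows "(\<lambda>y. Min X + y) ` Y \<union> (\<lambda>x. x + Max Y) ` X \<subseteq> X + Y"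
  using Min_in[OF assms(1,3)] Max_in[OF assms(2,4)] by (auto intro: set_plus_intro)

lemma card_set_plus_ge:
  fixes X Y :: "'a::linordered_ab_group_add set"
  assumes "finite X" "finite Y" "X \<noteq> {}" "Y \<noteq> {}"
  shows "card X + card Y \<le> Suc (card (X + Y))"
  using card_extreme_translates[OF assms]
    card_mono[OF finite_set_plus[OF assms(1,2)] extreme_translates_subset[OF assms]]
  by simp

text \<open>Closure under steps of \<open>d\<close> away from the two ends expresses that
  \<open>B\<close> is an arithmetic progression without enumerating it; the later inductions use
  exactly this form.\<close>

lemma small_doubling_imp_progression:
  fixes B :: "'a::linordered_ab_group_add set"
  assumes fin: "finite B" and two: "card B \<ge> 2" and small: "card (B + B) \<le> 2 * card B - 1"
  obtains d where "d > 0"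
    and "\<And>x. x \<in> B \<Longrightarrow> x \<noteq> Min B \<Longrightarrow> x - d \<in> B"
    and "\<And>x. x \<in> B \<Longrightarrow> x \<noteq> Max B \<Longrightarrow> x + d \<in> B"
proof -
  define p q r where "p = Min B" and "q = Min (B - {p})" and "r = Max B"
  have ne: "B \<noteq> {}" using two by auto
  have p: "p \<in> B" and r: "r \<in> B" using fin ne by (auto simp: p_def r_def)
  have "card (B - {p}) \<ge> 1" using two p fin by simp
  then have "B - {p} \<noteq> {}" by (metis card.empty not_one_le_zero)
  then have "q \<in> B - {p}" unfolding q_def using fin by (intro Min_in) auto
  then have q: "q \<in> B" "q \<noteq> p" by auto
  have p_le: "p \<le> x" and r_ge: "x \<le> r" if "x \<in> B" for x
    using that fin by (auto simp: p_def r_def)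
  have q_le: "q \<le> x" if "x \<in> B" "x \<noteq> p" for x
    using that fin by (auto simp: q_def)
  have pq: "p < q" using p_le q by force
  then have pr: "p < r" using r_ge[OF q(1)] by order
  have BB: "B + B = (\<lambda>y. p + y) ` B \<union> (\<lambda>x. x + r) ` B"
    unfolding p_def r_def
    using card_extreme_translates[OF fin fin ne ne] small
    by (intro card_seteq[symmetric] finite_set_plus extreme_translates_subset fin ne) linarith
  \<comment> \<open>Both sets have \<open>card B - 2\<close> elements, so one inclusion yields
    equality. For \<open>card B = 2\<close> we have \<open>q = r\<close> and both are empty.\<close>
  let ?W = "(\<lambda>x. q + x) ` (B - {p, r})" and ?Z = "(\<lambda>x. p + x) ` (B - {p, q})"
  have "?W \<subseteq> ?Z"
  proof
    fix w assume "w \<in> ?W"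
    then obtain x where x: "x \<in> B" "x \<noteq> p" "x \<noteq> r" "w = q + x" by auto
    have "w \<in> B + B" using x q by auto
    \<comment> \<open>Here \<open>x < r\<close> forces \<open>y < q\<close>, hence
      \<open>y = p\<close>, and the sum \<open>p + r\<close> also lies in the other
      translate.\<close>
    moreover have "w \<in> (\<lambda>y. p + y) ` B" if y: "y \<in> B" "w = y + r" for y
    proof -
      have "x < r" using r_ge x by force
      then have "y + r < q + r" using x y by simp
      then have "y < q" by simp
      then have "y = p" using q_le y by force
      then show ?thesis using y r by auto
    qed
    ultimately obtain y where y: "y \<in> B" "w = p + y" using BB by auto
    have "q \<le> x" using q_le x by blast
    then have "q < y"
      using x y pq
      by (metis add_less_cancel_left add.commute add_strict_right_mono add_left_mono order.strict_trans1 order.strict_trans2)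
    then show "w \<in> ?Z" using y pq by auto
  qed
  moreover have "card ?W = card ?Z"
    using pr pq p q r fin by (simp add: card_image inj_on_def card_Diff_subset)
  ultimately have WZ: "?W = ?Z" using fin by (intro card_subset_eq) auto
  show thesis
  proof (rule that[of "q - p"])
    show "0 < q - p" using pq by simp
    show "x - (q - p) \<in> B" if "x \<in> B" "x \<noteq> Min B" for x
    \<comment> \<open>\<open>q\<close> is the one point besides \<open>p\<close> that
      \<open>?Z\<close> leaves out; its predecessor is \<open>p\<close> itself.\<close>
    proof (cases "x = q")
      case True
      then show ?thesis using p by simp
    next
      case False
      then have "p + x \<in> ?W" using that unfolding WZ by (simp add: p_def)
      then obtain y where "y \<in> B" "p + x = q + y" by auto
      then have "x - (q - p) = y" by (simp add: algebra_simps)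
      then show ?thesis using \<open>y \<in> B\<close> by simp
    qed
    show "x + (q - p) \<in> B" if "x \<in> B" "x \<noteq> Max B" for x
    proof (cases "x = p")
      case True
      then show ?thesis using q by simp
    next
      case False
      then have "q + x \<in> ?Z" using that unfolding WZ[symmetric] by (simp add: r_def)
      then obtain y where "y \<in> B" "q + x = p + y" by auto
      then have "x + (q - p) = y" by (simp add: algebra_simps)
      then show ?thesis using \<open>y \<in> B\<close> by simp
    qed
  qed
qed

section \<open>Bounds for signed sumsets\<close>

lemma signed_sumset_eq_le:
  assumes fin: "finite A" and zero: "0 \<in> A"
  shows "signed_sumset h A = {(\<Sum>a\<in>A. c a * a) | c. (\<Sum>a\<in>A. \<bar>c a\<bar>) \<le> int h}"
proof (intro equalityI subsetI)
  fix x assume "x \<in> {(\<Sum>a\<in>A. c a * a) | c. (\<Sum>a\<in>A. \<bar>c a\<bar>) \<le> int h}"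
  then obtain c where c: "x = (\<Sum>a\<in>A. c a * a)" "(\<Sum>a\<in>A. \<bar>c a\<bar>) \<le> int h" by auto
  \<comment> \<open>The coefficient of 0 does not affect the sum, so it can absorb the missing norm.
    What is left for it is nonnegative, so the total becomes exactly \<open>h\<close>.\<close>
  define c' where "c' = c(0 := int h - (\<Sum>a\<in>A - {0}. \<bar>c a\<bar>))"
  have "(\<Sum>a\<in>A - {0}. \<bar>c a\<bar>) \<le> int h"
    using c(2) sum.remove[OF fin zero, of "\<lambda>a. \<bar>c a\<bar>"] by simp
  then have "(\<Sum>a\<in>A. \<bar>c' a\<bar>) = int h"
    using sum.remove[OF fin zero, of "\<lambda>a. \<bar>c' a\<bar>"] by (simp add: c'_def)
  moreover have "(\<Sum>a\<in>A. c' a * a) = x"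
    unfolding c by (rule sum.cong) (auto simp: c'_def)
  ultimately show "x \<in> signed_sumset h A" unfolding signed_sumset_def by auto
qed (auto simp: signed_sumset_def)

lemma abs_signed_sum_le:
  fixes c :: "int \<Rightarrow> int"
  assumes "\<forall>a\<in>A. \<bar>a\<bar> \<le> M"
  shows "\<bar>\<Sum>a\<in>A. c a * a\<bar> \<le> (\<Sum>a\<in>A. \<bar>c a\<bar>) * M"
proof -
  have "\<bar>\<Sum>a\<in>A. c a * a\<bar> \<le> (\<Sum>a\<in>A. \<bar>c a * a\<bar>)" by (rule sum_abs)
  also have "\<dots> \<le> (\<Sum>a\<in>A. \<bar>c a\<bar> * M)"
    using assms by (intro sum_mono) (auto simp: abs_mult intro: mult_left_mono)
  finally show ?thesis by (simp add: sum_distrib_right)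
qed

lemma finite_signed_sumset:
  assumes "finite A"
  shows "finite (signed_sumset h A)"
proof -
  \<comment> \<open>Inserting 0 keeps the maximum meaningful for empty \<open>A\<close>.\<close>
  define M where "M = Max (insert 0 (abs ` A))"
  have "\<forall>a\<in>A. \<bar>a\<bar> \<le> M" using assms by (auto simp: M_def)
  then have "\<bar>x\<bar> \<le> int h * M" if "x \<in> signed_sumset h A" for x
    using that abs_signed_sum_le[of A M] by (auto simp: signed_sumset_def) metis
  then have "signed_sumset h A \<subseteq> {- (int h * M)..int h * M}"
    by (force simp: abs_le_iff)
  then show ?thesis by (rule finite_subset) simp
qed

text \<open>Adding an element or its negative changes one coefficient by 1 or -1. The norm may drop
  instead of rising, which is why the form with norm at most \<open>Suc h\<close> is needed.\<close>

lemma set_plus_signed_sumset_subset: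
  assumes fin: "finite A" and zero: "0 \<in> A"
  shows "(A \<union> uminus ` A) + signed_sumset h A \<subseteq> signed_sumset (Suc h) A"
proof
  fix x assume "x \<in> (A \<union> uminus ` A) + signed_sumset h A"
  then obtain b y where x: "x = b + y" "b \<in> A \<union> uminus ` A" "y \<in> signed_sumset h A"
    by (elim set_plus_elim)
  then obtain c where c: "y = (\<Sum>a\<in>A. c a * a)" "(\<Sum>a\<in>A. \<bar>c a\<bar>) = int h"
    by (auto simp: signed_sumset_def)
  from x(2) obtain a0 s where a0: "a0 \<in> A" "b = s * a0" "\<bar>s\<bar> = (1::int)"
    by (force intro: that[of _ 1] that[of _ "-1"])
  define c' where "c' = (\<lambda>a. c a + (if a = a0 then s else 0))"
  have "(\<Sum>a\<in>A. c' a * a) = (\<Sum>a\<in>A. c a * a + (if a = a0 then s * a0 else 0))"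
    by (rule sum.cong) (auto simp: c'_def algebra_simps)
  then have "(\<Sum>a\<in>A. c' a * a) = x"
    using a0 fin by (simp add: sum.distrib x c)
  moreover have "(\<Sum>a\<in>A. \<bar>c' a\<bar>) \<le> (\<Sum>a\<in>A. \<bar>c a\<bar> + (if a = a0 then 1 else 0))"
    using a0 by (intro sum_mono) (auto simp: c'_def)
  then have "(\<Sum>a\<in>A. \<bar>c' a\<bar>) \<le> int (Suc h)"
    using a0 fin by (simp add: sum.distrib c)
  ultimately show "x \<in> signed_sumset (Suc h) A"
    unfolding signed_sumset_eq_le[OF fin zero] by auto
qed

text \<open>Each increase of \<open>h\<close> gains at least \<open>card B - 1\<close>. The
  induction starts at 2 and keeps \<open>card (B + B)\<close> in the bound, so that equality for any
  \<open>h\<close> limits the doubling of \<open>B\<close>.\<close>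

lemma card_signed_sumset_ge:
  fixes A :: "int set"
  defines "B \<equiv> A \<union> uminus ` A"
  assumes fin: "finite A" and zero: "0 \<in> A" and h: "h \<ge> 2"
  shows "card (B + B) + (h - 2) * (card B - 1) \<le> card (signed_sumset h A)"
  using h
proof (induction h rule: dec_induct)
  have step: "B + signed_sumset n A \<subseteq> signed_sumset (Suc n) A" for n
    unfolding B_def by (rule set_plus_signed_sumset_subset[OF fin zero])
  have finB: "finite B" and B: "B \<noteq> {}" using fin zero by (auto simp: B_def)
  {
    case base
    have "0 \<in> signed_sumset 0 A" by (auto simp: signed_sumset_def intro: exI[of _ "\<lambda>_. 0"])
    then have "B \<subseteq> signed_sumset 1 A" using step[of 0] set_zero_plus2[of "signed_sumset 0 A" B]
      by (auto simp: add.commute)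
    then have "B + B \<subseteq> signed_sumset 2 A" using step[of 1]
      by (simp add: numeral_2_eq_2) (meson order_refl order_trans set_plus_mono2)
    then show ?case using card_mono[OF finite_signed_sumset[OF fin]] by simp
  next
    case (step n)
    have "0 \<in> signed_sumset n A"
      unfolding signed_sumset_eq_le[OF fin zero] by (auto intro: exI[of _ "\<lambda>_. 0"])
    then have "card B + card (signed_sumset n A) \<le> Suc (card (B + signed_sumset n A))"
      by (intro card_set_plus_ge finB finite_signed_sumset fin B) auto
    also have "card (B + signed_sumset n A) \<le> card (signed_sumset (Suc n) A)"
      by (intro card_mono finite_signed_sumset fin \<open>B + signed_sumset n A \<subseteq> _\<close>)
    finally have "card B + card (signed_sumset n A) \<le> Suc (card (signed_sumset (Suc n) A))"
      by simp
    moreover have "card B \<ge> 1" using finB B by (simp add: Suc_le_eq card_gt_0_iff)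
    moreover have "Suc n - 2 = Suc (n - 2)" using step.hyps by simp
    ultimately show ?case using step.IH by simp
  }
qed

section \<open>From small doubling to dilates, and back\<close>

lemma card_symmetric_union:
  fixes A :: "int set"
  assumes "finite A" "\<forall>a\<in>A. a \<ge> 0" "0 \<in> A"
  shows "Suc (card (A \<union> uminus ` A)) = 2 * card A"
proof -
  have "A \<inter> uminus ` A = {0}" using assms(2,3) by (auto simp: image_iff intro: antisym)
  then show ?thesis
    using card_Un_Int[of A "uminus ` A"] assms card_image[of uminus A] by (simp add: inj_on_def)
qed

text \<open>Steps down to \<open>Min B\<close>, taken from \<open>x\<close> and from 0, show that
  \<open>d\<close> divides every \<open>x\<close> in \<open>A\<close>; steps up from 0 reach every
  multiple of \<open>d\<close> up to \<open>Max A\<close>.\<close>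

lemma symmetric_small_doubling_imp_dilate:
  fixes A :: "int set"
  defines "B \<equiv> A \<union> uminus ` A"
  assumes fin: "finite A" and nonneg: "\<forall>a\<in>A. a \<ge> 0" and zero: "0 \<in> A"
    and small: "card (B + B) \<le> 2 * card B - 1"
  shows "\<exists>d>0. A = dilate d {0..int (card A) - 1}"
\<comment> \<open>Then \<open>B = {0}\<close> is too small to determine a difference, and any
  positive \<open>d\<close> works.\<close>
proof (cases "card A = 1")
  case True
  then have "A = {0}" using zero by (auto simp: card_1_singleton_iff)
  then show ?thesis by (auto simp: dilate_def intro: exI[of _ 1])
next
  case False
  moreover have "card A \<noteq> 0" using fin zero by auto
  ultimately have "card B \<ge> 2"
    using card_symmetric_union[OF fin nonneg zero] by (simp add: B_def)
  moreover have finB: "finite B" using fin by (simp add: B_def)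
  ultimately obtain d where d: "d > 0"
    and down: "\<And>x. x \<in> B \<Longrightarrow> x \<noteq> Min B \<Longrightarrow> x - d \<in> B"
    and up: "\<And>x. x \<in> B \<Longrightarrow> x \<noteq> Max B \<Longrightarrow> x + d \<in> B"
    using small_doubling_imp_progression[OF _ _ small] by metis
  define m where "m = Max A"
  have m: "m \<in> A" "\<And>a. a \<in> A \<Longrightarrow> a \<le> m" using fin Max_in[OF fin] \<open>card A \<noteq> 0\<close> by (auto simp: m_def)
  have "Max B = m" unfolding B_def
  proof (rule Max_eqI)
    show "y \<le> m" if "y \<in> A \<union> uminus ` A" for y
      using that m nonneg by force
  qed (use m fin in auto)
  have AB: "a \<in> A" if "a \<in> B" "a \<ge> 0" for a
    using that nonneg zero unfolding B_def by force
  have dvd_Min: "d dvd x - Min B" if "x \<in> B" for x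
    using that
  proof (induction "nat (x - Min B)" arbitrary: x rule: less_induct)
    case less
    show ?case
    proof (cases "x = Min B")
      case False
      then have xd: "x - d \<in> B" using down less by auto
      then have "Min B \<le> x - d" using finB by simp
      then have "d dvd (x - d) - Min B" using xd d by (intro less.hyps) auto
      then show ?thesis using dvd_add[of d "x - d - Min B" d] by (simp add: algebra_simps)
    qed simp
  qed
  have dvd: "d dvd x" if "x \<in> A" for x
    using dvd_diff[OF dvd_Min[of x] dvd_Min[of 0]] that zero by (simp add: B_def)
  obtain j where j: "m = d * j" using dvd m by blast
  have j0: "j \<ge> 0" using m nonneg j d by (metis zero_le_mult_iff not_less)
  have mult: "d * int i \<in> A" if "int i \<le> j" for i
    using that
  proof (induction i)
    case 0
    then show ?case using zero by simp
  next
    case (Suc i)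
    \<comment> \<open>Since \<open>i + 1 \<le> j\<close>, the point \<open>d * int i\<close> is
      below \<open>m = d * j\<close>, so the step up is allowed.\<close>
    then have "d * int i \<in> B" "d * int i \<noteq> Max B"
      using d j \<open>Max B = m\<close> by (auto simp: B_def)
    then have "d * int i + d \<in> B" by (rule up)
    then show ?case using d by (intro AB) (auto simp: algebra_simps)
  qed
  have A: "A = (\<lambda>i. d * i) ` {0..j}"
  proof (intro equalityI subsetI)
    fix x assume x: "x \<in> A"
    then obtain i where i: "x = d * i" using dvd by blast
    have "i \<ge> 0" using x nonneg i d by (metis zero_le_mult_iff not_less)
    moreover have "i \<le> j" using m(2)[OF x] i j d by simp
    ultimately show "x \<in> (\<lambda>i. d * i) ` {0..j}" using i by auto
  next
    fix x assume "x \<in> (\<lambda>i. d * i) ` {0..j}"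
    then show "x \<in> A"
    proof
      fix i assume "x = d * i" "i \<in> {0..j}"
      then show "x \<in> A" using mult[of "nat i"] by simp
    qed
  qed
  have "card ((\<lambda>i. d * i) ` {0..j}) = card {0..j}"
    using d by (intro card_image) (simp add: inj_on_def)
  then have "j = int (card A) - 1" unfolding A[symmetric] using j0 by simp
  moreover have "A = dilate d {0..j}" using A by (simp add: dilate_def image_def Bex_def conj_commute)
  ultimately have "A = dilate d {0..int (card A) - 1}" by (rule subst)
  with d show ?thesis by (intro exI conjI)
qed

text \<open>Every signed sum is a multiple of \<open>d\<close> of absolute value at most
  \<open>h * d * n\<close>, and there are \<open>2 * h * n + 1\<close> of these.\<close>

lemma card_signed_sumset_dilate_le:
  assumes d: "d > 0"
  shows "card (signed_sumset h (dilate d {0..int n})) \<le> 2 * h * n + 1"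
proof -
  have "signed_sumset h (dilate d {0..int n}) \<subseteq> (\<lambda>i. d * i) ` {- (int h * int n)..int h * int n}"
  proof
    fix x assume "x \<in> signed_sumset h (dilate d {0..int n})"
    then obtain c where x: "x = (\<Sum>a\<in>dilate d {0..int n}. c a * a)"
      and c: "(\<Sum>a\<in>dilate d {0..int n}. \<bar>c a\<bar>) = int h"
      by (auto simp: signed_sumset_def)
    have "\<bar>a\<bar> \<le> d * int n" if "a \<in> dilate d {0..int n}" for a
      using that d by (auto simp: dilate_def abs_mult)
    then have "\<bar>x\<bar> \<le> int h * (d * int n)"
      unfolding x c[symmetric] by (intro abs_signed_sum_le) auto
    moreover have "d dvd x" unfolding x by (intro dvd_sum) (auto simp: dilate_def)
    then obtain i where i: "x = d * i" by blast
    ultimately have "d * \<bar>i\<bar> \<le> d * (int h * int n)" using d by (simp add: abs_mult mult_ac)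
    then have "\<bar>i\<bar> \<le> int h * int n" using d by simp
    then show "x \<in> (\<lambda>i. d * i) ` {- (int h * int n)..int h * int n}" unfolding i by (intro imageI) auto
  qed
  then have "card (signed_sumset h (dilate d {0..int n})) \<le> card {- (int h * int n)..int h * int n}"
    by (rule surj_card_le[rotated]) simp
  also have "\<dots> = 2 * h * n + 1"
  proof -
    have "int h * int n - - (int h * int n) + 1 = int (2 * h * n + 1)" by simp
    then show ?thesis unfolding card_atLeastAtMost_int by linarith
  qed
  finally show ?thesis .
qed

theorem theorem6:
  fixes h k :: nat and A :: "int set"
  assumes "h \<ge> 2"
    and "finite A"
    and "card A = k"
    and "\<forall>a\<in>A. a \<ge> 0"
    and "0 \<in> A"
  shows "int (card (signed_sumset h A)) = 2 * int h * int k - 2 * int h + 1 \<longleftrightarrow>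
    (\<exists>d::int. d > 0 \<and> A = dilate d {0..int k - 1})"
proof -
  define B where "B = A \<union> uminus ` A"
  have "k \<noteq> 0" using assms(2,3,5) card_0_eq by blast
  then obtain n where k: "k = Suc n" by (cases k) auto
  have cB: "card B = 2 * n + 1"
    using card_symmetric_union[of A] assms k by (simp add: B_def)
  have ge: "card (B + B) + (h - 2) * (2 * n) \<le> card (signed_sumset h A)"
    using card_signed_sumset_ge[of A h] assms cB by (simp add: B_def)
  \<comment> \<open>As \<open>2 * n = card B - 1\<close>, this splits off the growth beyond
    \<open>h = 2\<close>; cancelling it leaves \<open>card (B + B)\<close> against
    \<open>4 * n + 1 = 2 * card B - 1\<close>.\<close>
  have h: "h * (2 * n) = 2 * (2 * n) + (h - 2) * (2 * n)"
    using assms(1) by (simp add: algebra_simps flip: distrib_right)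
  have "2 * int h * int k - 2 * int h + 1 = int (h * (2 * n) + 1)"
    by (simp add: k algebra_simps)
  then have "int (card (signed_sumset h A)) = 2 * int h * int k - 2 * int h + 1
      \<longleftrightarrow> card (signed_sumset h A) = h * (2 * n) + 1"
    by (metis of_nat_eq_iff)
  also have "\<dots> \<longleftrightarrow> (\<exists>d>0. A = dilate d {0..int k - 1})"
  proof
    assume "card (signed_sumset h A) = h * (2 * n) + 1"
    then have "card (B + B) \<le> 2 * card B - 1" using ge h cB by simp
    then show "\<exists>d>0. A = dilate d {0..int k - 1}"
      using symmetric_small_doubling_imp_dilate[of A] assms by (simp add: B_def)
  next
    assume "\<exists>d>0. A = dilate d {0..int k - 1}"
    then have "card (signed_sumset h A) \<le> h * (2 * n) + 1"
      using card_signed_sumset_dilate_le[of _ h n] by (auto simp: k mult_ac)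
    moreover have "2 * card B \<le> Suc (card (B + B))"
      using card_set_plus_ge[of B B] assms(2) cB by (cases "B = {}") (auto simp: B_def)
    ultimately show "card (signed_sumset h A) = h * (2 * n) + 1" using ge h cB by simp
  qed
  finally show ?thesis .
qed

end
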